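(* For a fixed integer $k\ge 1$, a lower bound $L_k$ for the sequence $\{a_{n,k}\}_{n\ge 1}$, independent of $n$, is given by $$L_k = 1-\sum_{i\ge 2}\frac{(k!)^i}{(ik)!}.$$ That is, $a_{n,k}\ge L_k$ for all $n\ge 1$, where $a_{n,k}$ is the proportion of minimally overlapping patterns in $\mathcal{F}_{n,k}$.
   Context: For $n,k\ge 1$, $\mathcal{F}_{n,k}$ is the set of column-strict arrays with $n$ columns and $k$ rows: fillings of a rectangular array with $n$ columns and $k$ rows by the numbers $1,2,\ldots,kn$, each used exactly once, such that the entries increase from bottom to top in each column. Columns are labeled from left to right. If $F$ is a filling of a rectangle with $n$ columns and $k$ rows by distinct positive integers increasing from bottom to top in each column, then $\mathrm{red}(F)\in\mathcal{F}_{n,k}$ is obtained by replacing the $i$th smallest entry of $F$ by $i$, for all $i$. For $F\in\mathcal{F}_{n,k}$ and $1\le c_1<\cdots<c_j\le n$, $F[c_1,\ldots,c_j]$ is the filling with $j$ columns whose $a$th column is column $c_a$ of $F$. For $P\in\mathcal{F}_{j,k}$ and $F\in\mathcal{F}_{n,k}$ with $j\le n$, there is a $P$-match in $F$ starting at position $i$ if $\mathrm{red}(F[i,i+1,\ldots,i+j-1])=P$; $P\text{-mch}(F)$ is the number of $P$-matches in $F$. The pattern $P\in\mathcal{F}_{j,k}$ is minimally overlapping if the smallest $i$ for which there exists $F\in\mathcal{F}_{i,k}$ with $P\text{-mch}(F)=2$ is $i=2j-1$ (so two consecutive $P$-matches can overlap only in a single column, the last column of the first match and the first column of the second). $M_{n,k}$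 is the number of minimally overlapping $P\in\mathcal{F}_{n,k}$, and $a_{n,k}=M_{n,k}/|\mathcal{F}_{n,k}|$.
   Formalization: For n = 1 the one-column pattern is counted as minimally overlapping; under the literal definition (smallest i equal to 2j−1 = 1) it is not, so a_{1,k} = 0 < L_k (e.g. L_1 = 3 − e) and the claim would fail at n = 1. *)

theory Defs
  imports Complex_Main
begin

text \<open>
  An array is the list of its columns, from left to right; a column is the list of its
  entries, from bottom to top. Column labels and match positions start at 1.
\<close>

definition arrays :: "nat \<Rightarrow> nat \<Rightarrow> nat list list set" where
  "arrays n k = {F. length F = n \<and>
                    (\<forall>c \<in> set F. length c = k \<and> sorted_wrt (<) c) \<and>
                    distinct (concat F) \<and> set (concat F) = {1..k * n}}"

definition red :: "nat list list \<Rightarrow> nat list list" where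
  "red F = map (map (\<lambda>x. card {y \<in> set (concat F). y \<le> x})) F"

definition select_columns :: "nat list list \<Rightarrow> nat list \<Rightarrow> nat list list" where
  "select_columns F cs = map (\<lambda>c. F ! (c - 1)) cs"

definition match_at :: "nat list list \<Rightarrow> nat list list \<Rightarrow> nat \<Rightarrow> bool" where
  "match_at P F i \<longleftrightarrow>
     1 \<le> i \<and> i + length P \<le> length F + 1 \<and> red (select_columns F [i..<i + length P]) = P"

definition mch :: "nat list list \<Rightarrow> nat list list \<Rightarrow> nat" where
  "mch P F = card {i. match_at P F i}"

text \<open>
  For \<open>j \<ge> 2\<close> the condition says that \<open>2 * j - 1\<close> is the least number of columns of an array with
  exactly two matches of \<open>P\<close>. For \<open>j = 1\<close> two matches at different positions have no column in
  common, so nothing is required: the least number of columns is then 2 and never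
  \<open>2 * j - 1 = 1\<close>, and the clause below counts the only one-column pattern as
  minimally overlapping.
\<close>

definition minimally_overlapping :: "nat \<Rightarrow> nat \<Rightarrow> nat list list \<Rightarrow> bool" where
  "minimally_overlapping j k P \<longleftrightarrow>
     P \<in> arrays j k \<and>
     (j = 1 \<or>
      (\<exists>F \<in> arrays (2 * j - 1) k. mch P F = 2) \<and>
      (\<forall>i < 2 * j - 1. \<not> (\<exists>F \<in> arrays i k. mch P F = 2)))"

definition num_minimal :: "nat \<Rightarrow> nat \<Rightarrow> nat" where
  "num_minimal n k = card {P. minimally_overlapping n k P}"

definition prop_minimal :: "nat \<Rightarrow> nat \<Rightarrow> real" where
  "prop_minimal n k = real (num_minimal n k) / real (card (arrays n k))"

text \<open>The summation index is shifted so that the sum runs over all \<open>i \<ge> 2\<close>.\<close>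

definition lower_bound :: "nat \<Rightarrow> real" where
  "lower_bound k = 1 - (\<Sum>i. fact k ^ (i + 2) / fact ((i + 2) * k))"

end

theory Submission
  imports Defs
begin

text \<open>
  If two matches of \<open>P\<close> can share at least two columns, then for some \<open>m\<close> with
  \<open>2 \<le> m < n\<close> the first \<open>m\<close> and the last \<open>m\<close> columns of
  \<open>P\<close> have the same reduction; conversely two copies of \<open>P\<close> can always be glued along
  a single column. Such a \<open>P\<close> is determined by the actual entries of its first
  \<open>n - m\<close> columns, even when \<open>2 * m > n\<close>: moving right by \<open>n - m\<close> columns
  preserves the order of entries, so every orbit of this shift is monotone, and two arrays that agree on
  the first \<open>n - m\<close> columns are seen to agree on increasing orbits by induction on the entry,
  and on decreasing ones by complementation. Extending those columns by an arbitrary filling of the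
  remaining \<open>m\<close> columns shows that the proportion of such \<open>P\<close> is at most
  \<open>(k!)\<^sup>m / (m k)!\<close>, and a union bound over \<open>m\<close> finishes the proof.
\<close>

section \<open>Orders invariant under a shift\<close>

text \<open>Two numberings \<open>s\<close> and \<open>t\<close> of the cells \<open>X\<close>, with
  \<open>T\<close> a shift defined on the cells \<open>X1\<close> only. Since \<open>d\<close> grows
  along \<open>T\<close>, following \<open>T\<close> backwards from any cell ends in
  \<open>A\<close>, where the numberings agree.\<close>

locale shifted_orders =
  fixes X X1 A :: "'a set" and T :: "'a \<Rightarrow> 'a" and d :: "'a \<Rightarrow> nat" and s t :: "'a \<Rightarrow> nat"
  assumes fin: "finite X"
    and T_in: "\<And>x. x \<in> X1 \<Longrightarrow> x \<in> X \<and> T x \<in> X \<and> d x < d (T x)"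
    and cover: "\<And>y. y \<in> X \<Longrightarrow> y \<in> A \<or> (\<exists>x \<in> X1. y = T x)"
    and inj_s: "inj_on s X" and inj_t: "inj_on t X"
    and img: "s ` X = t ` X"
    and ord_s: "\<And>x y. x \<in> X1 \<Longrightarrow> y \<in> X1 \<Longrightarrow> s x < s y \<longleftrightarrow> s (T x) < s (T y)"
    and ord_t: "\<And>x y. x \<in> X1 \<Longrightarrow> y \<in> X1 \<Longrightarrow> t x < t y \<longleftrightarrow> t (T x) < t (T y)"
    and agree: "\<And>x. x \<in> A \<Longrightarrow> s x = t x"
begin

lemma swap: "shifted_orders X X1 A T d t s"
  by (rule shifted_orders.intro)
    (fact fin T_in cover inj_s inj_t img[symmetric] ord_s ord_t agree[symmetric])+

text \<open>Below the value of \<open>x\<close>, the positions for \<open>s\<close> are closed under predecessors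
  and those for \<open>t\<close> under successors, so the former set is contained in the latter; but they
  have the same size.\<close>

lemma same_direction:
  assumes x: "x \<in> X1" and up: "s x < s (T x)" and eq: "s x = t x"
  shows "t x < t (T x)"
proof (rule ccontr)
  assume "\<not> t x < t (T x)"
  moreover have "t x \<noteq> t (T x)"
    using inj_t T_in[OF x] by (metis inj_onD less_irrefl)
  ultimately have down: "t (T x) < t x" by simp
  define U where "U = {y \<in> X. s y < s x}"
  define U' where "U' = {y \<in> X. t y < s x}"
  have sub: "y \<in> U \<longrightarrow> y \<in> U'" for y
  proof (induction "d y" arbitrary: y rule: less_induct)
    case less
    show ?case
    proof
      assume yU: "y \<in> U"
      hence yX: "y \<in> X" and ys: "s y < s x" by (auto simp: U_def)
      from cover[OF yX] show "y \<in> U'"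
      proof
        assume "y \<in> A"
        thus ?thesis using agree yX ys by (auto simp: U'_def)
      next
        assume "\<exists>z \<in> X1. y = T z"
        then obtain z where z: "z \<in> X1" "y = T z" by blast
        \<comment> \<open>Since \<open>x\<close> rises under \<open>s\<close>, the cell
          \<open>y = T z\<close> also lies below \<open>T x\<close>; invariance pulls this back to
          \<open>z\<close> and \<open>x\<close>.\<close>
        have "s (T z) < s (T x)" using ys up z by simp
        hence "s z < s x" using ord_s z x by blast
        hence "z \<in> U" using T_in z by (auto simp: U_def)
        hence "z \<in> U'" using less T_in z by blast
        hence "t z < t x" using eq by (auto simp: U'_def)
        hence "t (T z) < t (T x)" using ord_t z x by blast
        thus ?thesis using down eq z yX by (auto simp: U'_def)
      qed
    qed
  qed
  \<comment> \<open>Both sets are the preimages of the same initial segment of the common value set,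
    hence equinumerous.\<close>
  have img1: "s ` U = {v \<in> s ` X. v < s x}" by (auto simp: U_def)
  have img2: "t ` U' = {v \<in> t ` X. v < s x}" by (auto simp: U'_def)
  have "card U = card (s ` U)"
    by (rule card_image[symmetric], rule inj_on_subset[OF inj_s]) (auto simp: U_def)
  also have "\<dots> = card (t ` U')" using img1 img2 img by simp
  also have "\<dots> = card U'"
    by (rule card_image, rule inj_on_subset[OF inj_t]) (auto simp: U'_def)
  finally have "card U = card U'" .
  moreover have "finite U'" "U \<subseteq> U'" using fin sub by (auto simp: U'_def)
  ultimately have "U = U'" by (metis card_subset_eq)
  moreover have "T x \<in> U'" using down eq T_in[OF x] by (auto simp: U'_def)
  ultimately have "s (T x) < s x" by (auto simp: U_def)
  thus False using up by simp
qed

definition up :: "('a \<Rightarrow> nat) \<Rightarrow> 'a \<Rightarrow> bool" where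
  "up f y \<longleftrightarrow> y \<in> X \<and> (y \<in> A \<or> (\<exists>x \<in> X1. y = T x \<and> f x < f y))"

text \<open>Orbits are monotone: if \<open>x = T w\<close>, then comparing \<open>w\<close> with
  \<open>x\<close> is equivalent to comparing \<open>x\<close> with \<open>T x\<close>.\<close>

lemma up_pred:
  assumes "x \<in> X1" "s x < s (T x)"
  shows "up s x"
proof -
  have xX: "x \<in> X" using T_in assms by blast
  from cover[OF xX] show ?thesis
  proof
    assume "\<exists>w \<in> X1. x = T w"
    then obtain w where w: "w \<in> X1" "x = T w" by blast
    hence "s w < s x" using ord_s[of w x] assms by simp
    thus ?thesis unfolding up_def using w(1,2) xX by blast
  qed (simp add: up_def xX)
qed

text \<open>The predecessor \<open>x\<close> of \<open>y\<close> has the same value under both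
  numberings, so by \<open>same_direction\<close> it also rises under \<open>t\<close>. Then
  \<open>t y < s y\<close> contradicts \<open>IH'\<close> at \<open>y\<close> itself, which leaves
  \<open>s y < t y\<close>.\<close>

lemma up_step:
  assumes IH: "\<And>z. up s z \<Longrightarrow> s z < s y \<Longrightarrow> t z = s z"
    and IH': "\<And>z. up t z \<Longrightarrow> t z < s y \<Longrightarrow> s z = t z"
    and y: "up s y"
  shows "t y = s y"
proof (cases "y \<in> A")
  case True
  thus ?thesis using agree by simp
next
  case False
  interpret sw: shifted_orders X X1 A T d t s by (rule swap)
  have yX: "y \<in> X" using y by (simp add: up_def)
  obtain x where x: "x \<in> X1" "y = T x" "s x < s y" using y False unfolding up_def by blast
  have tx: "t x = s x" using IH up_pred x by blast
  have txy: "t x < t y" using same_direction[OF x(1) _ tx[symmetric]] x by simp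
  hence upt: "up t y" unfolding up_def using x yX by blast
  show ?thesis
  proof (rule ccontr)
    assume ne: "t y \<noteq> s y"
    have "\<not> t y < s y" using IH'[OF upt] ne by auto
    hence gt: "s y < t y" using ne by simp
    \<comment> \<open>Here \<open>t\<close> must take the value \<open>s y\<close> at another cell
      \<open>y'\<close>. Its predecessor lies below \<open>x\<close>, so \<open>IH'\<close> applies
      there and makes \<open>y'\<close> an increasing cell for \<open>s\<close> below
      \<open>y\<close>; now \<open>IH\<close> contradicts the choice of \<open>y'\<close>.\<close>
    have "s y \<in> t ` X" using img yX by blast
    then obtain y' where y': "y' \<in> X" "t y' = s y" by auto
    have "y' \<notin> A"
    proof
      assume "y' \<in> A"
      hence "s y' = s y" using agree y' by simp
      hence "y' = y" using inj_s y' yX by (meson inj_onD)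
      thus False using y' ne by simp
    qed
    then obtain x' where x': "x' \<in> X1" "y' = T x'" using cover y' by blast
    have "t (T x') < t (T x)" using gt y' x' x by simp
    hence lt: "t x' < t x" using ord_t x x' by blast
    hence lt': "t x' < t (T x')" using tx x y' x' by simp
    have "up t x'" by (rule sw.up_pred[OF x'(1) lt'])
    moreover have "t x' < s y" using lt tx x by simp
    ultimately have sx': "s x' = t x'" using IH' by blast
    hence "s x' < s x" using lt tx by simp
    hence lt2: "s y' < s y" using ord_s x x' by blast
    have "s x' < s y'" using sw.same_direction[OF x'(1) lt' sx'[symmetric]] x' by simp
    hence "up s y'" unfolding up_def using x' y' by blast
    hence "t y' = s y'" using IH lt2 by blast
    thus False using lt2 y' by simp
  qed
qed

text \<open>Both directions go through one induction on the value, because the step for each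
  numbering uses the hypothesis for the other.\<close>

lemma up_agree: "(\<forall>y. up s y \<and> s y = v \<longrightarrow> t y = v) \<and> (\<forall>y. up t y \<and> t y = v \<longrightarrow> s y = v)"
proof (induction v rule: less_induct)
  case (less v)
  interpret sw: shifted_orders X X1 A T d t s by (rule swap)
  have IH: "t z = s z" if "up s z" "s z < v" for z
    using less.IH that by blast
  have IH': "s z = t z" if "up t z" "t z < v" for z
    using less.IH that by blast
  have "t y = v" if "up s y" "s y = v" for y
    using up_step[OF _ _ that(1)] IH IH' unfolding that(2) by blast
  moreover have "s y = v" if "up t y" "t y = v" for y
    using sw.up_step[OF _ _ that(1)] IH IH' unfolding that(2) by blast
  ultimately show ?case by blast
qed

lemma eq_if_up: "up s y \<Longrightarrow> s y = t y"
  using up_agree by metis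

end

text \<open>A cell that is not \<open>up\<close> is reached by a decreasing step. Replacing each
  value \<open>v\<close> by \<open>N - v\<close> reverses all comparisons and makes that step
  increasing.\<close>

lemma shifted_orders_eq:
  assumes "shifted_orders X X1 A T d s t" and y: "y \<in> X"
  shows "s y = t y"
proof -
  interpret shifted_orders X X1 A T d s t by fact
  \<comment> \<open>Equal images make \<open>N\<close> an upper bound for \<open>t\<close> as well,
    so the truncated subtractions below lose nothing.\<close>
  define N where "N = Max (s ` X)"
  have Ns: "s x \<le> N" if "x \<in> X" for x
    using fin that by (simp add: N_def)
  have Nt: "t x \<le> N" if "x \<in> X" for x
    using fin that by (simp add: N_def img)
  have less_s: "N - s x < N - s z \<longleftrightarrow> s z < s x" if "x \<in> X" "z \<in> X" for x z
    using Ns[OF that(1)] Ns[OF that(2)] by linarith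
  have less_t: "N - t x < N - t z \<longleftrightarrow> t z < t x" if "x \<in> X" "z \<in> X" for x z
    using Nt[OF that(1)] Nt[OF that(2)] by linarith
  interpret r: shifted_orders X X1 A T d "\<lambda>x. N - s x" "\<lambda>x. N - t x"
  proof
    show "inj_on (\<lambda>x. N - s x) X"
      using inj_s Ns by (auto simp: inj_on_def) (metis diff_diff_cancel)
    show "inj_on (\<lambda>x. N - t x) X"
      using inj_t Nt by (auto simp: inj_on_def) (metis diff_diff_cancel)
    have "(\<lambda>v. N - v) ` s ` X = (\<lambda>v. N - v) ` t ` X" using img by simp
    thus "(\<lambda>x. N - s x) ` X = (\<lambda>x. N - t x) ` X" by (simp add: image_image)
  qed (use fin T_in cover ord_s ord_t agree less_s less_t in auto)
  show ?thesis
  proof (cases "up s y")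
    case True
    thus ?thesis by (rule eq_if_up)
  next
    case False
    then obtain x where x: "x \<in> X1" "y = T x" "\<not> s x < s y"
      using cover[OF y] y by (auto simp: up_def)
    have "s x \<noteq> s y" using inj_s T_in[OF x(1)] x(2) by (metis inj_onD less_irrefl)
    hence "N - s x < N - s y" using less_s x T_in y by auto
    hence "r.up (\<lambda>x. N - s x) y" using x y by (auto simp: r.up_def)
    hence "N - s y = N - t y" by (rule r.eq_if_up)
    thus ?thesis using Ns[OF y] Nt[OF y] by linarith
  qed
qed

section \<open>Counting fillings\<close>

text \<open>The entry set is arbitrary, so that entries may be removed: those of the first column in
  the count by induction, later those of a fixed prefix.\<close>

definition fillings :: "nat set \<Rightarrow> nat \<Rightarrow> nat \<Rightarrow> nat list list set" where
  "fillings V n k = {F. length F = n \<and>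
                    (\<forall>c \<in> set F. length c = k \<and> sorted_wrt (<) c) \<and>
                    distinct (concat F) \<and> set (concat F) = V}"

lemma arrays_eq_fillings: "arrays n k = fillings {1..k * n} n k"
  by (simp add: arrays_def fillings_def)

lemma length_concat_uniform:
  "\<forall>c \<in> set F. length c = k \<Longrightarrow> length (concat F) = length F * k"
  by (induction F) auto

lemma card_strict_sorted_lists:
  fixes V :: "'a::linorder set"
  assumes "finite V"
  shows "card {c. length c = k \<and> sorted_wrt (<) c \<and> set c \<subseteq> V} = card V choose k"
    and "finite {c. length c = k \<and> sorted_wrt (<) c \<and> set c \<subseteq> V}"
proof -
  let ?L = "{c. length c = k \<and> sorted_wrt (<) c \<and> set c \<subseteq> V}"
  have "bij_betw set ?L {S. S \<subseteq> V \<and> card S = k}"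
  proof (rule bij_betw_imageI)
    show "inj_on set ?L" by (auto simp: inj_on_def intro: strict_sorted_equal)
    show "set ` ?L = {S. S \<subseteq> V \<and> card S = k}"
    proof (intro equalityI subsetI)
      fix S assume "S \<in> set ` ?L"
      thus "S \<in> {S. S \<subseteq> V \<and> card S = k}"
        by (auto simp: strict_sorted_iff distinct_card)
    next
      fix S assume S: "S \<in> {S. S \<subseteq> V \<and> card S = k}"
      hence "finite S" using assms finite_subset by auto
      hence "set (sorted_list_of_set S) = S" "sorted_list_of_set S \<in> ?L"
        using S by (auto simp: strict_sorted_iff)
      thus "S \<in> set ` ?L" by (metis image_eqI)
    qed
  qed
  thus "card ?L = card V choose k" "finite ?L"
    using n_subsets[OF assms, of k] assms by (simp_all add: bij_betw_same_card bij_betw_finite)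
qed

lemma fillings_Suc:
  "fillings V (Suc n) k =
    (\<lambda>(c, F). c # F) ` (SIGMA c : {c. length c = k \<and> sorted_wrt (<) c \<and> set c \<subseteq> V}.
      fillings (V - set c) n k)"
proof (intro equalityI subsetI)
  fix F assume F: "F \<in> fillings V (Suc n) k"
  then obtain c G where "F = c # G" by (auto simp: fillings_def length_Suc_conv)
  thus "F \<in> (\<lambda>(c, F). c # F) ` (SIGMA c : {c. length c = k \<and> sorted_wrt (<) c \<and> set c \<subseteq> V}.
      fillings (V - set c) n k)"
    using F by (intro image_eqI[of _ _ "(c, G)"]) (auto simp: fillings_def)
next
  fix F assume "F \<in> (\<lambda>(c, F). c # F) ` (SIGMA c : {c. length c = k \<and> sorted_wrt (<) c \<and> set c \<subseteq> V}.
      fillings (V - set c) n k)"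
  then obtain c G where cG: "F = c # G" "length c = k" "sorted_wrt (<) c" "set c \<subseteq> V"
    "G \<in> fillings (V - set c) n k" by auto
  have "set (concat F) = V" "set c \<inter> set (concat G) = {}"
    using cG by (auto simp: fillings_def simp del: set_concat)
  thus "F \<in> fillings V (Suc n) k"
    using cG by (auto simp: fillings_def strict_sorted_iff)
qed

text \<open>The multinomial count, written without division: choose the entries of the first column,
  then fill the other columns with what is left.\<close>

lemma card_fillings:
  assumes "finite V" "card V = n * k"
  shows "finite (fillings V n k) \<and> card (fillings V n k) * fact k ^ n = (fact (n * k) :: nat)"
  using assms
proof (induction n arbitrary: V)
  case 0
  hence "fillings V 0 k = {[]}" by (auto simp: fillings_def)
  thus ?case by simp
next
  case (Suc n)
  let ?L = "{c. length c = k \<and> sorted_wrt (<) c \<and> set c \<subseteq> V}"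
  have IH: "finite (fillings (V - set c) n k) \<and>
      card (fillings (V - set c) n k) * fact k ^ n = (fact (n * k) :: nat)" if "c \<in> ?L" for c
  proof (rule Suc.IH)
    have "card (set c) = k" using that by (auto simp: strict_sorted_iff distinct_card)
    thus "card (V - set c) = n * k" using that Suc.prems by (auto simp: card_Diff_subset)
  qed (use Suc.prems in simp)
  have finL: "finite ?L" by (rule card_strict_sorted_lists(2)[OF Suc.prems(1)])
  have fin: "finite (fillings V (Suc n) k)"
    unfolding fillings_Suc using finL IH by (intro finite_imageI finite_SigmaI) auto
  have "card (fillings V (Suc n) k) = (\<Sum>c\<in>?L. card (fillings (V - set c) n k))"
    unfolding fillings_Suc using finL IH
    by (subst card_image) (auto simp: inj_on_def intro!: card_SigmaI)
  hence "card (fillings V (Suc n) k) * fact k ^ n =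
      (\<Sum>c\<in>?L. card (fillings (V - set c) n k) * fact k ^ n)"
    by (simp add: sum_distrib_right)
  also have "\<dots> = (\<Sum>c\<in>?L. fact (n * k))"
    by (rule sum.cong[OF refl]) (use IH in blast)
  also have "\<dots> = (Suc n * k choose k) * fact (n * k)"
    using card_strict_sorted_lists(1)[OF Suc.prems(1), of k] Suc.prems(2) by simp
  finally have "card (fillings V (Suc n) k) * fact k ^ Suc n =
      fact k * fact (Suc n * k - k) * (Suc n * k choose k)"
    by (simp add: mult_ac)
  also have "\<dots> = fact (Suc n * k)" by (rule binomial_fact_lemma) simp
  finally show ?case using fin by simp
qed

lemma finite_arrays: "finite (arrays n k)"
  and card_arrays: "card (arrays n k) * fact k ^ n = (fact (n * k) :: nat)"
  using card_fillings[of "{1..k * n}" n k] by (simp_all add: arrays_eq_fillings mult.commute)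

lemma card_arrays_pos: "card (arrays n k) > 0"
  using card_arrays[of n k] by (metis fact_gt_zero gr0I less_irrefl mult_zero_left)

section \<open>Reduction\<close>

definition rank :: "nat set \<Rightarrow> nat \<Rightarrow> nat" where
  "rank V x = card {y \<in> V. y \<le> x}"

lemma red_rank: "red F = map (map (rank (set (concat F)))) F"
  by (simp add: red_def rank_def)

lemma rank_less:
  assumes "finite V" "y \<in> V" "x < y"
  shows "rank V x < rank V y"
  unfolding rank_def
proof (rule psubset_card_mono)
  have "y \<in> {z \<in> V. z \<le> y}" "y \<notin> {z \<in> V. z \<le> x}" using assms by auto
  moreover have "{z \<in> V. z \<le> x} \<subseteq> {z \<in> V. z \<le> y}" using assms by auto
  ultimately show "{z \<in> V. z \<le> x} \<subset> {z \<in> V. z \<le> y}" by blast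
qed (use assms in simp)

lemma strict_mono_on_rank: "finite V \<Longrightarrow> strict_mono_on V (rank V)"
  by (intro strict_mono_onI rank_less)

lemma rank_less_iff:
  assumes "finite V" "x \<in> V" "y \<in> V"
  shows "rank V x < rank V y \<longleftrightarrow> x < y"
  using strict_mono_on_less[OF strict_mono_on_rank] assms by blast

lemma rank_image:
  assumes "finite V"
  shows "rank V ` V = {1..card V}"
proof (rule card_subset_eq)
  have "rank V x \<ge> 1 \<and> rank V x \<le> card V" if "x \<in> V" for x
  proof
    have "{y \<in> V. y \<le> x} \<noteq> {}" using that by auto
    thus "rank V x \<ge> 1" using assms by (simp add: rank_def Suc_le_eq card_gt_0_iff)
    show "rank V x \<le> card V" using assms by (auto simp: rank_def intro: card_mono)
  qed
  thus "rank V ` V \<subseteq> {1..card V}" by auto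
  show "card (rank V ` V) = card {1..card V}"
    using strict_mono_on_imp_inj_on[OF strict_mono_on_rank[OF assms]] by (simp add: card_image)
qed simp

lemma sorted_wrt_map_strict_mono:
  assumes "strict_mono_on V f" "set c \<subseteq> V" "sorted_wrt (<) c"
  shows "sorted_wrt (<) (map f c)"
  using assms by (auto simp: sorted_wrt_map strict_mono_on_def intro: sorted_wrt_mono_rel[rotated])

lemma red_in_arrays:
  assumes "length F = n" "\<forall>c \<in> set F. length c = k \<and> sorted_wrt (<) c" "distinct (concat F)"
  shows "red F \<in> arrays n k"
proof -
  let ?V = "set (concat F)"
  have cr: "concat (red F) = map (rank ?V) (concat F)" by (simp add: red_rank map_concat)
  have sm: "strict_mono_on ?V (rank ?V)" by (rule strict_mono_on_rank) simp
  have "card ?V = n * k" using assms length_concat_uniform[of F k] distinct_card[of "concat F"] by metis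
  hence "set (concat (red F)) = {1..k * n}"
    using rank_image[of ?V] unfolding cr by (simp add: mult.commute)
  moreover have "distinct (concat (red F))"
    unfolding cr using assms(3) strict_mono_on_imp_inj_on[OF sm] by (simp add: distinct_map)
  moreover have "sorted_wrt (<) (map (rank ?V) c)" if "c \<in> set F" for c
    using sorted_wrt_map_strict_mono[OF sm] that assms by auto
  ultimately show ?thesis using assms by (auto simp: arrays_def red_rank)
qed

lemma red_arrays:
  assumes "P \<in> arrays n k"
  shows "red P = P"
proof -
  have V: "set (concat P) = {1..k * n}" using assms by (simp add: arrays_def)
  have "rank {1..k * n} x = x" if "x \<in> {1..k * n}" for x
  proof -
    have "{y \<in> {1..k * n}. y \<le> x} = {1..x}" using that by auto
    thus ?thesis by (simp add: rank_def)
  qed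
  moreover have "x \<in> {1..k * n}" if "c \<in> set P" "x \<in> set c" for c x
    using that unfolding V[symmetric] by auto
  ultimately have "map (rank (set (concat P))) c = c" if "c \<in> set P" for c
    unfolding V using that by (intro map_idI) blast
  thus ?thesis unfolding red_rank by (rule map_idI)
qed

text \<open>An increasing relabelling keeps the number of entries below or equal to each
  entry.\<close>

lemma red_map_strict_mono:
  assumes "strict_mono_on V f" "set (concat F) \<subseteq> V"
  shows "red (map (map f) F) = red F"
proof -
  let ?W = "set (concat F)"
  have W: "set (concat (map (map f) F)) = f ` ?W" by (simp add: map_concat[symmetric] image_UN)
  have "rank (f ` ?W) (f x) = rank ?W x" if "x \<in> ?W" for x
  proof -
    have "{y \<in> f ` ?W. y \<le> f x} = f ` {y \<in> ?W. y \<le> x}"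
      using strict_mono_on_less_eq[OF assms(1)] assms(2) that by blast
    moreover have "inj_on f {y \<in> ?W. y \<le> x}"
      using strict_mono_on_imp_inj_on[OF assms(1)] assms(2) by (auto intro: inj_on_subset)
    ultimately show ?thesis by (simp add: rank_def card_image)
  qed
  thus ?thesis unfolding red_rank W by auto
qed

text \<open>Reducing the whole array is itself an increasing relabelling, so it does not affect the
  reduction of a block of columns.\<close>

lemma red_take_drop: "red (take a (drop b (red F))) = red (take a (drop b F))"
proof -
  have "red (map (map (rank (set (concat F)))) (take a (drop b F))) = red (take a (drop b F))"
    by (rule red_map_strict_mono[OF strict_mono_on_rank])
      (auto dest: in_set_takeD in_set_dropD)
  thus ?thesis by (simp add: red_rank[of F] take_map drop_map)
qed

lemma nth_nth_in_set_concat: "c < length F \<Longrightarrow> r < length (F ! c) \<Longrightarrow> F ! c ! r \<in> set (concat F)"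
  unfolding set_concat by (meson UN_I nth_mem)

lemma red_eq_imp_less_iff:
  assumes "red F = red G" "c < length F" "r < length (F ! c)" "c' < length F" "r' < length (F ! c')"
  shows "F ! c ! r < F ! c' ! r' \<longleftrightarrow> G ! c ! r < G ! c' ! r'"
proof -
  have len: "length F = length G" using arg_cong[OF assms(1), of length] by (simp add: red_rank)
  have len': "length (F ! i) = length (G ! i)" if "i < length F" for i
    using arg_cong[OF assms(1), of "\<lambda>H. length (H ! i)"] that len by (simp add: red_rank)
  have eq: "rank (set (concat F)) (F ! i ! j) = rank (set (concat G)) (G ! i ! j)"
    if "i < length F" "j < length (F ! i)" for i j
    using arg_cong[OF assms(1), of "\<lambda>H. H ! i ! j"] that len len' by (simp add: red_rank)
  have "F ! c ! r < F ! c' ! r' \<longleftrightarrow>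
      rank (set (concat F)) (F ! c ! r) < rank (set (concat F)) (F ! c' ! r')"
    using assms by (subst rank_less_iff) (auto simp del: set_concat intro: nth_nth_in_set_concat)
  also have "\<dots> \<longleftrightarrow> rank (set (concat G)) (G ! c ! r) < rank (set (concat G)) (G ! c' ! r')"
    using eq assms by simp
  also have "\<dots> \<longleftrightarrow> G ! c ! r < G ! c' ! r'"
    using assms len len'
    by (subst rank_less_iff) (auto simp del: set_concat intro: nth_nth_in_set_concat)
  finally show ?thesis .
qed

section \<open>Borders\<close>

text \<open>The analogue of a border of a word, with equality of prefix and suffix replaced by equal
  relative order.\<close>

definition bordered :: "nat \<Rightarrow> nat \<Rightarrow> nat \<Rightarrow> nat list list set" where
  "bordered n k m = {P \<in> arrays n k. red (take m P) = red (drop (n - m) P)}"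

lemma finite_bordered: "finite (bordered n k m)"
  by (simp add: bordered_def finite_arrays)

lemma image_entries:
  assumes "length F = n" "\<forall>c \<in> set F. length c = k"
  shows "(\<lambda>(c, r). F ! c ! r) ` ({..<n} \<times> {..<k}) = set (concat F)"
proof (intro equalityI subsetI)
  fix v assume "v \<in> set (concat F)"
  then obtain c where c: "c \<in> set F" "v \<in> set c" by auto
  obtain i where "i < n" "F ! i = c" using c assms by (metis in_set_conv_nth)
  moreover obtain j where "j < k" "c ! j = v" using c assms by (metis in_set_conv_nth)
  ultimately show "v \<in> (\<lambda>(c, r). F ! c ! r) ` ({..<n} \<times> {..<k})" by force
next
  fix v assume "v \<in> (\<lambda>(c, r). F ! c ! r) ` ({..<n} \<times> {..<k})"
  thus "v \<in> set (concat F)"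
    using assms by (auto simp del: set_concat intro!: nth_nth_in_set_concat)
qed

text \<open>As many cells as values: surjectivity forces injectivity.\<close>

lemma inj_on_entries:
  assumes "P \<in> arrays n k"
  shows "inj_on (\<lambda>(c, r). P ! c ! r) ({..<n} \<times> {..<k})"
proof (rule eq_card_imp_inj_on)
  have "(\<lambda>(c, r). P ! c ! r) ` ({..<n} \<times> {..<k}) = {1..k * n}"
    using assms image_entries[of P n k] by (simp add: arrays_def)
  thus "card ((\<lambda>(c, r). P ! c ! r) ` ({..<n} \<times> {..<k})) = card ({..<n} \<times> {..<k})"
    by simp
qed simp

lemma bordered_less_iff:
  assumes "P \<in> bordered n k m" "m \<le> n" "c < m" "c' < m" "r < k" "r' < k"
  shows "P ! c ! r < P ! c' ! r' \<longleftrightarrow> P ! (n - m + c) ! r < P ! (n - m + c') ! r'"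
proof -
  have P: "length P = n" "\<And>i. i < n \<Longrightarrow> length (P ! i) = k"
    and eq: "red (take m P) = red (drop (n - m) P)"
    using assms(1) by (auto simp: bordered_def arrays_def)
  have "take m P ! c ! r < take m P ! c' ! r' \<longleftrightarrow>
      drop (n - m) P ! c ! r < drop (n - m) P ! c' ! r'"
    by (rule red_eq_imp_less_iff[OF eq]) (use assms P in auto)
  thus ?thesis using assms P by simp
qed

lemma inj_on_take_bordered:
  assumes "m < n"
  shows "inj_on (take (n - m)) (bordered n k m)"
proof (rule inj_onI)
  fix P Q assume PQ: "P \<in> bordered n k m" "Q \<in> bordered n k m" "take (n - m) P = take (n - m) Q"
  let ?p = "n - m"
  have aP: "P \<in> arrays n k" and aQ: "Q \<in> arrays n k" using PQ by (auto simp: bordered_def)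
  have img: "(\<lambda>(c, r). F ! c ! r) ` ({..<n} \<times> {..<k}) = {1..k * n}" if "F \<in> arrays n k" for F
    using that image_entries[of F n k] by (simp add: arrays_def)
  \<comment> \<open>Cells are pairs of column and row, and the shift moves right by
    \<open>n - m\<close> columns. The column index increases strictly because
    \<open>m < n\<close>.\<close>
  have "shifted_orders ({..<n} \<times> {..<k}) ({..<m} \<times> {..<k}) ({..<?p} \<times> {..<k})
      (\<lambda>(c, r). (?p + c, r)) fst (\<lambda>(c, r). P ! c ! r) (\<lambda>(c, r). Q ! c ! r)"
  proof
    fix y :: "nat \<times> nat" assume y: "y \<in> {..<n} \<times> {..<k}"
    obtain c r where cr: "y = (c, r)" by (cases y)
    show "y \<in> {..<?p} \<times> {..<k} \<or> (\<exists>x \<in> {..<m} \<times> {..<k}. y = (\<lambda>(c, r). (?p + c, r)) x)"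
    proof (cases "c < ?p")
      case False
      hence "(c - ?p, r) \<in> {..<m} \<times> {..<k}" "y = (\<lambda>(c, r). (?p + c, r)) (c - ?p, r)"
        using y cr assms by auto
      thus ?thesis by blast
    qed (use y cr in auto)
  next
    fix x :: "nat \<times> nat" assume x: "x \<in> {..<?p} \<times> {..<k}"
    have "P ! c = Q ! c" if "c < ?p" for c
      using arg_cong[OF PQ(3), of "\<lambda>F. F ! c"] that by simp
    thus "(case x of (c, r) \<Rightarrow> P ! c ! r) = (case x of (c, r) \<Rightarrow> Q ! c ! r)"
      using x by (auto split: prod.splits)
  next
    fix x y assume xy: "x \<in> {..<m} \<times> {..<k}" "y \<in> {..<m} \<times> {..<k}"
    show "((case x of (c, r) \<Rightarrow> P ! c ! r) < (case y of (c, r) \<Rightarrow> P ! c ! r)) \<longleftrightarrow>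
      ((case case x of (c, r) \<Rightarrow> (?p + c, r) of (c, r) \<Rightarrow> P ! c ! r)
        < (case case y of (c, r) \<Rightarrow> (?p + c, r) of (c, r) \<Rightarrow> P ! c ! r))"
      using bordered_less_iff[OF PQ(1)] xy assms by (auto split: prod.splits)
    show "((case x of (c, r) \<Rightarrow> Q ! c ! r) < (case y of (c, r) \<Rightarrow> Q ! c ! r)) \<longleftrightarrow>
      ((case case x of (c, r) \<Rightarrow> (?p + c, r) of (c, r) \<Rightarrow> Q ! c ! r)
        < (case case y of (c, r) \<Rightarrow> (?p + c, r) of (c, r) \<Rightarrow> Q ! c ! r))"
      using bordered_less_iff[OF PQ(2)] xy assms by (auto split: prod.splits)
  qed (use assms img[OF aP] img[OF aQ] inj_on_entries[OF aP] inj_on_entries[OF aQ] in auto)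
  from shifted_orders_eq[OF this] have eq: "P ! c ! r = Q ! c ! r" if "c < n" "r < k" for c r
    using that by force
  show "P = Q"
  proof (rule nth_equalityI)
    show "length P = length Q" using aP aQ by (simp add: arrays_def)
    fix c assume "c < length P"
    thus "P ! c = Q ! c"
      using aP aQ eq by (intro nth_equalityI) (auto simp: arrays_def)
  qed
qed

lemma card_bordered:
  assumes m: "m < n"
  shows "card (bordered n k m) * fact (m * k) \<le> card (arrays n k) * fact k ^ m"
proof -
  let ?p = "n - m"
  define Pre where "Pre = take ?p ` bordered n k m"
  let ?R = "\<lambda>B. fillings ({1..k * n} - set (concat B)) m k"
  have fin: "finite Pre" by (simp add: Pre_def finite_bordered)
  have cardPre: "card (bordered n k m) = card Pre"
    unfolding Pre_def using card_image[OF inj_on_take_bordered[OF m]] by simp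
  have Pre: "length B = ?p \<and> (\<forall>c \<in> set B. length c = k \<and> sorted_wrt (<) c) \<and>
      distinct (concat B) \<and> set (concat B) \<subseteq> {1..k * n}" if B: "B \<in> Pre" for B
  proof -
    obtain P where P: "P \<in> arrays n k" "B = take ?p P"
      using B by (auto simp: Pre_def bordered_def)
    have cP: "concat P = concat B @ concat (drop ?p P)"
      using P by (metis append_take_drop_id concat_append)
    hence "distinct (concat B)" using P by (auto simp: arrays_def)
    moreover have "set (concat B) \<subseteq> set (concat P)" unfolding cP by simp
    ultimately show ?thesis using P by (auto simp: arrays_def dest: in_set_takeD)
  qed
  have R: "finite (?R B) \<and> card (?R B) * fact k ^ m = (fact (m * k) :: nat)" if B: "B \<in> Pre" for B
  proof (rule card_fillings)
    have "card (set (concat B)) = ?p * k"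
      using Pre[OF B] length_concat_uniform[of B k] distinct_card[of "concat B"] by metis
    hence "card ({1..k * n} - set (concat B)) = k * n - ?p * k"
      using Pre[OF B] by (subst card_Diff_subset) auto
    thus "card ({1..k * n} - set (concat B)) = m * k"
      using m by (metis diff_diff_cancel diff_mult_distrib less_imp_le mult.commute)
  qed simp
  \<comment> \<open>All prefixes have the same length, so concatenation can be undone.\<close>
  have "card (Sigma Pre ?R) = card ((\<lambda>(B, G). B @ G) ` Sigma Pre ?R)"
    by (rule card_image[symmetric]) (auto simp: inj_on_def dest!: Pre)
  also have "\<dots> \<le> card (arrays n k)"
  proof (rule card_mono[OF finite_arrays])
    have "B @ G \<in> arrays n k" if B: "B \<in> Pre" and G: "G \<in> ?R B" for B G
    proof -
      have "set (concat (B @ G)) = {1..k * n}"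
        using Pre[OF B] G by (auto simp: fillings_def simp del: set_concat)
      moreover have "distinct (concat (B @ G))"
        using Pre[OF B] G by (auto simp: fillings_def simp del: set_concat)
      ultimately show ?thesis using Pre[OF B] G m by (auto simp: fillings_def arrays_def)
    qed
    thus "(\<lambda>(B, G). B @ G) ` Sigma Pre ?R \<subseteq> arrays n k" by auto
  qed
  finally have le: "card (Sigma Pre ?R) \<le> card (arrays n k)" .
  have "card (bordered n k m) * fact (m * k) = (\<Sum>B\<in>Pre. card (?R B) * fact k ^ m)"
    using R by (simp add: cardPre)
  also have "\<dots> = card (Sigma Pre ?R) * fact k ^ m"
    using fin R by (simp add: card_SigmaI sum_distrib_right)
  also have "\<dots> \<le> card (arrays n k) * fact k ^ m" using le by simp
  finally show ?thesis .
qed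

section \<open>Overlapping matches\<close>

lemma select_columns_interval:
  assumes "1 \<le> i" "i + n \<le> length F + 1"
  shows "select_columns F [i..<i + n] = take n (drop (i - 1) F)"
  using assms by (intro nth_equalityI) (auto simp: select_columns_def)

lemma match_at_iff:
  "match_at P F i \<longleftrightarrow> 1 \<le> i \<and> i + length P \<le> length F + 1 \<and>
    red (take (length P) (drop (i - 1) F)) = P"
  using select_columns_interval by (auto simp: match_at_def)

text \<open>The columns common to both matches end the first and begin the second, so the
  corresponding parts of \<open>P\<close> are reductions of one and the same block.\<close>

lemma two_matches_bordered:
  assumes P: "P \<in> arrays n k" and "match_at P F i" "match_at P F j" "i < j" "j < i + n"
  shows "P \<in> bordered n k (n - (j - i))"
proof -
  let ?d = "j - i"
  let ?m = "n - ?d"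
  have len: "length P = n" using P by (simp add: arrays_def)
  have 1: "red (take n (drop (i - 1) F)) = P" "red (take n (drop (j - 1) F)) = P"
    "1 \<le> i" using assms len by (auto simp: match_at_iff)
  have "red (take ?m P) = red (take ?m (drop (j - 1) F))"
    using red_take_drop[of ?m 0 "take n (drop (j - 1) F)", unfolded 1(2)] by simp
  moreover have "red (drop ?d P) = red (take ?m (drop ?d (take n (drop (i - 1) F))))"
    using red_take_drop[of ?m ?d "take n (drop (i - 1) F)", unfolded 1(1)] len by simp
  moreover have "take ?m (drop ?d (take n (drop (i - 1) F))) = take ?m (drop (j - 1) F)"
    using assms 1(3) by (simp add: drop_take)
  ultimately show ?thesis using P assms by (simp add: bordered_def)
qed

section \<open>Gluing two copies of a pattern along a single column\<close>

text \<open>\<open>glue L M b\<close> sends the \<open>j\<close>th smallest element of \<open>L\<close> to \<open>2 * M * j\<close> and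
  leaves room in between for two interleaved copies of the remaining entries below \<open>M\<close>, selected
  by \<open>b = 0\<close> and \<open>b = M\<close>.\<close>

definition glue :: "nat set \<Rightarrow> nat \<Rightarrow> nat \<Rightarrow> nat \<Rightarrow> nat" where
  "glue L M b x = 2 * M * rank L x + (if x \<in> L then 0 else b + x)"

text \<open>The second summand stays below \<open>2 * M\<close> and cannot outweigh a step in rank.
  For equal ranks the larger entry lies outside \<open>L\<close>, and the second summands
  decide.\<close>

lemma strict_mono_on_glue:
  assumes "finite L" "b \<le> M"
  shows "strict_mono_on {1..<M} (glue L M b)"
proof (rule strict_mono_onI)
  fix x y assume xy: "x \<in> {1..<M}" "y \<in> {1..<M}" "x < y"
  have le: "rank L x \<le> rank L y"
    unfolding rank_def using xy assms by (intro card_mono) auto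
  show "glue L M b x < glue L M b y"
  proof (cases "rank L x = rank L y")
    case True
    have "y \<notin> L" using rank_less[of L y x] xy assms True by auto
    thus ?thesis using True xy by (auto simp: glue_def)
  next
    case False
    hence "Suc (rank L x) \<le> rank L y" using le by simp
    hence "2 * M * Suc (rank L x) \<le> 2 * M * rank L y" by (rule mult_le_mono2)
    moreover have "(if x \<in> L then 0 else b + x) < 2 * M" using xy assms by auto
    ultimately show ?thesis unfolding glue_def mult_Suc_right by linarith
  qed
qed

text \<open>Modulo \<open>2 * M\<close> the left side has a residue below \<open>M\<close>, whereas
  \<open>y\<close> outside \<open>L'\<close> would give the residue \<open>M + y\<close>.\<close>

lemma glue_eq_imp:
  assumes "x \<in> {1..<M}" "y \<in> {1..<M}" "glue L M 0 x = glue L' M M y"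
  shows "y \<in> L'"
proof (rule ccontr)
  assume y: "y \<notin> L'"
  let ?a = "if x \<in> L then 0 else x"
  have "(2 * M * rank L x + ?a) mod (2 * M) = (2 * M * rank L' y + (M + y)) mod (2 * M)"
    using assms(3) y by (simp only: glue_def if_False add_0)
  hence "?a mod (2 * M) = (M + y) mod (2 * M)" by (simp only: mod_mult_self4 mod_mult_self3)
  thus False using assms by (auto split: if_splits)
qed

lemma rank_nth_strict_sorted:
  assumes "sorted_wrt (<) c" "j < length c"
  shows "rank (set c) (c ! j) = Suc j"
proof -
  have "{y \<in> set c. y \<le> c ! j} = set (take (Suc j) c)"
  proof (intro equalityI subsetI)
    fix y assume "y \<in> {y \<in> set c. y \<le> c ! j}"
    then obtain i where i: "i < length c" "y = c ! i" "c ! i \<le> c ! j"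
      by (auto simp: in_set_conv_nth)
    have "i \<le> j" using sorted_wrt_nth_less[OF assms(1), of j i] i assms by (metis leD leI)
    thus "y \<in> set (take (Suc j) c)" using i assms by (auto simp: in_set_conv_nth intro!: exI[of _ i])
  next
    fix y assume "y \<in> set (take (Suc j) c)"
    then obtain i where i: "i < Suc j" "y = c ! i" using assms by (auto simp: in_set_conv_nth)
    thus "y \<in> {y \<in> set c. y \<le> c ! j}"
      using sorted_wrt_nth_less[OF assms(1), of i j] assms
      by (cases "i = j") (auto intro: less_imp_le)
  qed
  moreover have "distinct c" using assms strict_sorted_iff by blast
  ultimately show ?thesis using assms by (simp add: rank_def distinct_card)
qed

text \<open>On its own column \<open>glue\<close> depends on the rank alone; this makes the shared
  columns of the two copies coincide.\<close>

lemma map_glue_self: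
  assumes "sorted_wrt (<) c" "sorted_wrt (<) c'" "length c = length c'"
  shows "map (glue (set c) M b) c = map (glue (set c') M b') c'"
  using assms by (intro nth_equalityI) (auto simp: glue_def rank_nth_strict_sorted)

lemma exists_end_overlap:
  assumes P: "P \<in> arrays n k" and n: "n \<ge> 1"
  shows "\<exists>F \<in> arrays (2 * n - 1) k. match_at P F 1 \<and> match_at P F n"
proof -
  have len: "length P = n" and col: "\<forall>c \<in> set P. length c = k \<and> sorted_wrt (<) c"
    and dist: "distinct (concat P)" and V: "set (concat P) = {1..k * n}"
    using P by (auto simp: arrays_def simp del: set_concat)
  have ne: "P \<noteq> []" using len n by auto
  define M where "M = Suc (k * n)"
  have V': "set (concat P) = {1..<M}" unfolding V M_def by auto
  define f where "f = glue (set (last P)) M 0"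
  define g where "g = glue (set (hd P)) M M"
  have mf: "strict_mono_on {1..<M} f" and mg: "strict_mono_on {1..<M} g"
    unfolding f_def g_def by (rule strict_mono_on_glue; simp)+
  have fg: "map f (last P) = map g (hd P)"
    unfolding f_def g_def using col ne by (intro map_glue_self) auto
  \<comment> \<open>The first column of the second copy is dropped, being already present as the
    last column of the first.\<close>
  define F where "F = map (map f) P @ tl (map (map g) P)"
  have lenF: "length F = 2 * n - 1" using len n by (simp add: F_def)
  have takeF: "take n F = map (map f) P" using len by (simp add: F_def)
  have "map (map f) P = map (map f) (butlast P) @ [map f (last P)]"
    using ne by (metis append_butlast_last_id list.simps(8,9) map_append)
  hence "drop (n - 1) (map (map f) P) = [map f (last P)]" using len by simp
  hence "drop (n - 1) F = map f (last P) # tl (map (map g) P)"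
    using len by (simp add: F_def del: drop_map)
  also have "\<dots> = map (map g) P" unfolding fg using ne by (cases P) simp_all
  finally have dropF: "drop (n - 1) F = map (map g) P" .
  have colF: "\<forall>c \<in> set F. length c = k \<and> sorted_wrt (<) c"
  proof
    fix c assume "c \<in> set F"
    then obtain h c' where h: "h = f \<or> h = g" "c' \<in> set P" "c = map h c'"
      using list.set_sel(2)[OF ne] by (auto simp: F_def map_tl[symmetric])
    moreover have "set c' \<subseteq> {1..<M}" using h V' by auto
    ultimately show "length c = k \<and> sorted_wrt (<) c"
      using col mf mg sorted_wrt_map_strict_mono[of "{1..<M}" h c'] by auto
  qed
  have cP: "concat P = hd P @ concat (tl P)" using ne by (cases P) auto
  have "distinct (concat F)"
  proof -
    have cF: "concat F = map f (concat P) @ map g (concat (tl P))"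
      by (simp add: F_def map_concat map_tl)
    have "distinct (map f (concat P))"
      using dist strict_mono_on_imp_inj_on[OF mf] unfolding distinct_map V' by simp
    moreover have "distinct (map g (concat P))"
      using dist strict_mono_on_imp_inj_on[OF mg] unfolding distinct_map V' by simp
    hence "distinct (map g (concat (tl P)))" unfolding cP by simp
    \<comment> \<open>A collision would put \<open>y\<close> into the first column of
      \<open>P\<close>, but \<open>y\<close> comes from the other columns.\<close>
    moreover have "f x \<noteq> g y" if "x \<in> set (concat P)" "y \<in> set (concat (tl P))" for x y
    proof
      assume "f x = g y"
      moreover have "y \<in> set (concat P)" unfolding cP using that by simp
      ultimately have "y \<in> set (hd P)"
        using that glue_eq_imp unfolding f_def g_def V' by blast
      thus False using that dist unfolding cP by auto
    qed
    ultimately show ?thesis unfolding cF distinct_append set_map by blast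
  qed
  hence "red F \<in> arrays (2 * n - 1) k" using red_in_arrays lenF colF by blast
  moreover have "red (take n (red F)) = P"
    using red_take_drop[of n 0 F] red_map_strict_mono[OF mf, of P] red_arrays[OF P] V' takeF
    by simp
  moreover have "red (take n (drop (n - 1) (red F))) = P"
    using red_take_drop[of n "n - 1" F] red_map_strict_mono[OF mg, of P] red_arrays[OF P] V' dropF len
    by simp
  moreover have "length (red F) = 2 * n - 1" using lenF by (simp add: red_rank)
  ultimately show ?thesis using n len by (intro bexI[of _ "red F"]) (auto simp: match_at_iff)
qed

text \<open>Without such borders, matches are at least \<open>n - 1\<close> positions apart. This
  excludes two matches in fewer than \<open>2 * n - 1\<close> columns and leaves the glued array
  with the matches at \<open>1\<close> and \<open>n\<close> only.\<close>

lemma not_minimal_imp_bordered: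
  assumes P: "P \<in> arrays n k" and n: "n \<ge> 2" and nm: "\<not> minimally_overlapping n k P"
  shows "\<exists>m \<in> {2..<n}. P \<in> bordered n k m"
proof (rule ccontr)
  assume nb: "\<not> (\<exists>m \<in> {2..<n}. P \<in> bordered n k m)"
  have len: "length P = n" using P by (simp add: arrays_def)
  have far: "i + (n - 1) \<le> j" if "match_at P F i" "match_at P F j" "i < j" for F i j
  proof (rule ccontr)
    assume lt: "\<not> i + (n - 1) \<le> j"
    hence "P \<in> bordered n k (n - (j - i))" using two_matches_bordered[OF P that] by simp
    \<comment> \<open>A distance from \<open>1\<close> to \<open>n - 2\<close> is an overlap in
      \<open>2\<close> to \<open>n - 1\<close> columns.\<close>
    moreover have "n - (j - i) \<in> {2..<n}" using lt that by auto
    ultimately show False using nb by blast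
  qed
  have "mch P F \<noteq> 2" if F: "F \<in> arrays l k" "l < 2 * n - 1" for F l
  proof
    assume "mch P F = 2"
    then obtain a b where ab: "match_at P F a" "match_at P F b" "a \<noteq> b"
      unfolding mch_def card_2_iff by blast
    then obtain i j where ij: "match_at P F i" "match_at P F j" "i < j"
      by (metis linorder_neqE_nat)
    have "i + (n - 1) \<le> j" using far ij by blast
    moreover have "length F = l" using F by (simp add: arrays_def)
    hence "1 \<le> i" "j + n \<le> l + 1" using ij len by (auto simp: match_at_iff)
    ultimately show False using F by simp
  qed
  moreover obtain F where F: "F \<in> arrays (2 * n - 1) k" "match_at P F 1" "match_at P F n"
    using exists_end_overlap[OF P] n by auto
  have "i = 1 \<or> i = n" if "match_at P F i" for i
  proof -
    have "length F = 2 * n - 1" using F by (simp add: arrays_def)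
    hence "1 \<le> i" "i \<le> n" using that len n by (auto simp: match_at_iff)
    moreover have "n \<le> i" if "i \<noteq> 1" using far[OF F(2) \<open>match_at P F i\<close>] that \<open>1 \<le> i\<close> by auto
    ultimately show ?thesis by auto
  qed
  hence "{i. match_at P F i} = {1, n}" using F by auto
  hence "mch P F = 2" using n by (simp add: mch_def)
  ultimately show False using nm P F by (auto simp: minimally_overlapping_def)
qed

section \<open>The lower bound\<close>

text \<open>The ratio of consecutive terms is the reciprocal of \<open>?N choose k\<close>, which is
  at least 2 since \<open>0 < k < ?N\<close>.\<close>

lemma summable_fact_ratio:
  assumes "k \<ge> 1"
  shows "summable (\<lambda>i. fact k ^ (i + 2) / fact ((i + 2) * k) :: real)"
proof (rule summable_ratio_test[of "1 / 2" 0])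
  fix i :: nat
  let ?N = "(Suc i + 2) * k"
  have "k < ?N" using assms by simp
  have N: "?N - k = (i + 2) * k" by (simp add: algebra_simps)
  have "?N choose k \<ge> 2"
  proof -
    \<comment> \<open>Pascal's rule splits the coefficient into two positive summands.\<close>
    have "Suc (?N - 1) choose Suc (k - 1) = (?N - 1 choose (k - 1)) + (?N - 1 choose Suc (k - 1))"
      by (rule binomial_Suc_Suc)
    moreover have "(?N - 1 choose (k - 1)) > 0" "(?N - 1 choose Suc (k - 1)) > 0"
      using assms \<open>k < ?N\<close> by (auto simp del: binomial_Suc_Suc)
    moreover have "Suc (?N - 1) = ?N" "Suc (k - 1) = k" using assms by simp_all
    ultimately have "?N choose k = (?N - 1 choose (k - 1)) + (?N - 1 choose Suc (k - 1))"
      by (simp only:)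
    thus ?thesis
      using \<open>(?N - 1 choose (k - 1)) > 0\<close> \<open>(?N - 1 choose Suc (k - 1)) > 0\<close> by linarith
  qed
  hence "fact k * fact ((i + 2) * k) * 2 \<le> fact k * fact (?N - k) * (?N choose k)"
    unfolding N by (intro mult_le_mono) auto
  also have "\<dots> = fact ?N" by (rule binomial_fact_lemma) simp
  finally have "real (fact k * fact ((i + 2) * k) * 2) \<le> real (fact ?N)" by (simp only: of_nat_le_iff)
  hence le: "fact k * fact ((i + 2) * k) * 2 \<le> (fact ?N :: real)"
    by (simp only: of_nat_mult of_nat_fact of_nat_numeral)
  have "fact k ^ (i + 2) * (fact k * fact ((i + 2) * k) * 2) \<le> fact k ^ (i + 2) * (fact ?N :: real)"
    by (rule mult_left_mono[OF le]) simp
  hence "fact k ^ (Suc i + 2) / fact ?N \<le> 1 / 2 * (fact k ^ (i + 2) / fact ((i + 2) * k) :: real)"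
    by (simp add: field_simps del: fact_Suc mult_Suc)
  thus "norm (fact k ^ (Suc i + 2) / fact ?N :: real)
      \<le> 1 / 2 * norm (fact k ^ (i + 2) / fact ((i + 2) * k) :: real)"
    by simp
qed simp

theorem theorem5:
  fixes n k :: nat
  assumes "k \<ge> 1" and "n \<ge> 1"
  shows "prop_minimal n k \<ge> lower_bound k"
proof -
  define a where "a = (\<lambda>i. fact k ^ i / fact (i * k) :: real)"
  have sm: "summable (\<lambda>i. a (i + 2))"
    unfolding a_def by (rule summable_fact_ratio[OF assms(1)])
  have a0: "a i \<ge> 0" for i by (simp add: a_def)
  let ?M = "{P. minimally_overlapping n k P}"
  have sub: "?M \<subseteq> arrays n k" by (auto simp: minimally_overlapping_def)
  have cpos: "real (card (arrays n k)) > 0" using card_arrays_pos by simp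
  have "arrays n k - ?M \<subseteq> (\<Union>m \<in> {2..<n}. bordered n k m)"
  proof
    fix P assume P: "P \<in> arrays n k - ?M"
    \<comment> \<open>For \<open>n = 1\<close> every array counts as minimally overlapping, so the
      complement is empty.\<close>
    hence "n \<noteq> 1" by (auto simp: minimally_overlapping_def)
    thus "P \<in> (\<Union>m \<in> {2..<n}. bordered n k m)"
      using not_minimal_imp_bordered[of P n k] P assms by auto
  qed
  hence "card (arrays n k - ?M) \<le> card (\<Union>m \<in> {2..<n}. bordered n k m)"
    by (intro card_mono) (auto simp: finite_bordered)
  also have "\<dots> \<le> (\<Sum>m\<in>{2..<n}. card (bordered n k m))" by (rule card_UN_le) simp
  finally have "real (card (arrays n k - ?M)) \<le> real (\<Sum>m\<in>{2..<n}. card (bordered n k m))"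
    by (simp only: of_nat_le_iff)
  also have "\<dots> = (\<Sum>m\<in>{2..<n}. real (card (bordered n k m)))" by (rule of_nat_sum)
  also have "\<dots> \<le> (\<Sum>m\<in>{2..<n}. real (card (arrays n k)) * a m)"
  proof (rule sum_mono)
    fix m assume "m \<in> {2..<n}"
    hence "real (card (bordered n k m) * fact (m * k)) \<le> real (card (arrays n k) * fact k ^ m)"
      using card_bordered[of m n k] by (simp only: of_nat_le_iff atLeastLessThan_iff)
    thus "real (card (bordered n k m)) \<le> real (card (arrays n k)) * a m"
      by (simp add: a_def field_simps)
  qed
  also have "\<dots> = real (card (arrays n k)) * (\<Sum>m\<in>{2..<n}. a m)" by (simp add: sum_distrib_left)
  \<comment> \<open>The shift matches the indexing of the series; for \<open>n = 1\<close> truncated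
    subtraction leaves both sums empty.\<close>
  also have "(\<Sum>m\<in>{2..<n}. a m) = (\<Sum>i<n - 2. a (i + 2))"
    by (rule sum.reindex_bij_witness[of _ "\<lambda>i. i + 2" "\<lambda>m. m - 2"])
      (auto simp del: add_2_eq_Suc')
  also have "real (card (arrays n k)) * \<dots> \<le> real (card (arrays n k)) * (\<Sum>i. a (i + 2))"
    using sm a0 by (intro mult_left_mono sum_le_suminf) auto
  finally have "real (card (arrays n k - ?M)) \<le> real (card (arrays n k)) * (\<Sum>i. a (i + 2))" .
  moreover have "real (card (arrays n k - ?M)) = real (card (arrays n k)) - real (card ?M)"
    using sub finite_arrays by (simp add: card_Diff_subset finite_subset of_nat_diff card_mono)
  ultimately have "1 - (\<Sum>i. a (i + 2)) \<le> real (card ?M) / real (card (arrays n k))"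
    using cpos by (simp add: field_simps)
  thus ?thesis by (simp add: lower_bound_def prop_minimal_def num_minimal_def a_def)
qed

end
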